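(* Fix a free Borel action $\mathbb{Z}^d=\langle e_0,\ldots,e_{d-1}\rangle\curvearrowright X$ on a standard Borel space $X$ and its grid graph $G$. Then: (0) If $G$ admits a Borel $2^d$-polychromatic coloring, then $G$ admits a $0$-fold invariant $d$-tuple of Borel $2$-colorings. (1) If $G$ admits a $(d-1)$-fold invariant $d$-tuple of Borel $2$-colorings, then $G$ admits a Borel $2^d$-polychromatic coloring. (2) When $d=2$, $G$ admits a Borel $4$-polychromatic coloring if and only if $G$ admits a $1$-fold invariant $2$-tuple of Borel $2$-colorings.
   Context: The grid graph $G$ of a free Borel action $\mathbb{Z}^d\curvearrowright X$ (with standard generators $e_0,\dots,e_{d-1}$) has vertex set $X$ and edges between $x$ and $e_i\cdot x$ for $x\in X$, $i<d$. A Borel $k$-polychromatic coloring of $G$ is a Borel map $c:X\to[k]$ such that for every $x\in X$ the unit cube $\{0,1\}^d\cdot x=\{g\cdot x:g\in\{0,1\}^d\}$ contains all $k$ colors. A proper $2$-coloring of the $i$-th $\mathbb{Z}$-subaction is a map $c_i:X\to\{0,1\}$ with $c_i(e_i\cdot x)\ne c_i(x)$ for all $x$. Such $c_i$ is orthogonally invariant (in direction $i$) on a set $Y$ if $c_i(e_j\cdot x)=c_i(x)$ for all $x\in Y$ and all $j\ne i$. A $d$-tuple of Borel $2$-colorings is a tuple $(c_0,\dots,c_{d-1})$ where each $c_i$ is a Borel proper $2$-coloring of the $i$-th $\mathbb{Z}$-subaction $\langle e_i\rangle\curvearrowright X$; it is $n$-fold invariant if for every orbit $[x]_{\mathbb{Z}^d}$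 there are at least $n$ indices $i<d$ such that $c_i$ is orthogonally invariant on $[x]_{\mathbb{Z}^d}$. *)

theory Defs
  imports "HOL-Analysis.Analysis"
begin

definition polish_topology :: "'a topology \<Rightarrow> bool" where
  "polish_topology T \<longleftrightarrow> completely_metrizable_space T \<and> second_countable T"

text \<open>Only the measurable space underlying \<open>M\<close> matters; its measure plays no role.\<close>

definition standard_borel_space :: "'a measure \<Rightarrow> bool" where
  "standard_borel_space M \<longleftrightarrow>
     (\<exists>T. polish_topology T \<and> space M = topspace T \<and>
          sets M = sigma_sets (topspace T) {U. openin T U})"

text \<open>
  The group \<open>\<int>\<^sup>d\<close> is \<open>int ^ 'd\<close> with \<open>d = CARD('d)\<close>, so the indices \<open>i < d\<close> are the
  elements of \<open>'d\<close>. As \<open>\<int>\<^sup>d\<close> is discrete, its Borel structure is \<open>count_space UNIV\<close>.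
\<close>

definition free_borel_action :: "'a measure \<Rightarrow> (int ^ 'd \<Rightarrow> 'a \<Rightarrow> 'a) \<Rightarrow> bool" where
  "free_borel_action M act \<longleftrightarrow>
     (\<lambda>(g, x). act g x) \<in> measurable (count_space UNIV \<Otimes>\<^sub>M M) M \<and>
     (\<forall>x\<in>space M. act 0 x = x) \<and>
     (\<forall>g h. \<forall>x\<in>space M. act (g + h) x = act g (act h x)) \<and>
     (\<forall>g. \<forall>x\<in>space M. act g x = x \<longrightarrow> g = 0)"

definition gen :: "'d \<Rightarrow> int ^ 'd" where
  "gen i = axis i 1"

definition orbit :: "(int ^ 'd \<Rightarrow> 'a \<Rightarrow> 'a) \<Rightarrow> 'a \<Rightarrow> 'a set" where
  "orbit act x = {act g x | g. True}"

definition unit_cube :: "(int ^ 'd \<Rightarrow> 'a \<Rightarrow> 'a) \<Rightarrow> 'a \<Rightarrow> 'a set" where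
  "unit_cube act x = {act g x | g. \<forall>i. g $ i \<in> {0, 1}}"

definition borel_polychromatic_coloring ::
    "'a measure \<Rightarrow> (int ^ 'd \<Rightarrow> 'a \<Rightarrow> 'a) \<Rightarrow> nat \<Rightarrow> ('a \<Rightarrow> nat) \<Rightarrow> bool" where
  "borel_polychromatic_coloring M act k c \<longleftrightarrow>
     c \<in> measurable M (count_space {..<k}) \<and>
     (\<forall>x\<in>space M. \<forall>a<k. \<exists>y\<in>unit_cube act x. c y = a)"

definition borel_proper_2_coloring ::
    "'a measure \<Rightarrow> (int ^ 'd \<Rightarrow> 'a \<Rightarrow> 'a) \<Rightarrow> 'd \<Rightarrow> ('a \<Rightarrow> nat) \<Rightarrow> bool" where
  "borel_proper_2_coloring M act i c \<longleftrightarrow>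
     c \<in> measurable M (count_space {0, 1}) \<and>
     (\<forall>x\<in>space M. c (act (gen i) x) \<noteq> c x)"

definition orthogonally_invariant_on ::
    "(int ^ 'd \<Rightarrow> 'a \<Rightarrow> 'a) \<Rightarrow> 'd \<Rightarrow> ('a \<Rightarrow> nat) \<Rightarrow> 'a set \<Rightarrow> bool" where
  "orthogonally_invariant_on act i c Y \<longleftrightarrow>
     (\<forall>x\<in>Y. \<forall>j. j \<noteq> i \<longrightarrow> c (act (gen j) x) = c x)"

definition tuple_of_borel_2_colorings ::
    "'a measure \<Rightarrow> (int ^ 'd \<Rightarrow> 'a \<Rightarrow> 'a) \<Rightarrow> ('d \<Rightarrow> 'a \<Rightarrow> nat) \<Rightarrow> bool" where
  "tuple_of_borel_2_colorings M act c \<longleftrightarrow> (\<forall>i. borel_proper_2_coloring M act i (c i))"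

definition fold_invariant ::
    "'a measure \<Rightarrow> (int ^ 'd \<Rightarrow> 'a \<Rightarrow> 'a) \<Rightarrow> nat \<Rightarrow> ('d \<Rightarrow> 'a \<Rightarrow> nat) \<Rightarrow> bool" where
  "fold_invariant M act n c \<longleftrightarrow>
     (\<forall>x\<in>space M. n \<le> card {i. orthogonally_invariant_on act i (c i) (orbit act x)})"

end

theory Submission
  imports Defs
begin

text \<open>
  Since a unit cube has \<open>2 ^ d\<close> vertices, a \<open>2 ^ d\<close>-polychromatic coloring is injective on every
  unit cube, so the unit cube at \<open>x\<close> meets the color class \<open>0\<close> in a single vertex \<open>g \<cdot> x\<close>; the
  coordinates \<open>g\<^sub>i\<close> of that vertex, as functions of \<open>x\<close>, are the 2-colorings of part (0). In terms
  of the tiling of each orbit by cubes given by the color class, they record the position of \<open>x\<close>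
  inside its tile. If \<open>d = 2\<close>, a square tiling slides along rows or along columns but not both,
  so on each orbit one of the two colorings is orthogonally invariant: failure of invariance spreads
  along the whole line in the direction of properness, and a bad row and a bad column would cross.

  Conversely, if all but one of the colorings \<open>c\<^sub>i\<close> are orthogonally invariant on an orbit, the tuple
  of all \<open>c\<^sub>i\<close> is polychromatic there: the invariant coordinates are set to prescribed values
  independently of each other, and moving in the remaining direction afterwards does not disturb
  them.
\<close>

section \<open>Vertices of a unit cube indexed by sets of directions\<close>

definition cube_vec :: "'d::finite set \<Rightarrow> int ^ 'd" where
  "cube_vec S = (\<chi> i. of_bool (i \<in> S))"

lemma cube_vec_nth [simp]: "cube_vec S $ i = of_bool (i \<in> S)"
  by (simp add: cube_vec_def)

lemma gen_nth: "gen i $ j = of_bool (j = i)"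
  by (simp add: gen_def axis_def)

lemma unit_cube_eq_range: "unit_cube act x = range (\<lambda>S. act (cube_vec S) x)"
proof (intro set_eqI iffI)
  fix y assume "y \<in> unit_cube act x"
  then obtain g where y: "y = act g x" and g: "\<forall>i. g $ i \<in> {0, 1}"
    by (auto simp: unit_cube_def)
  have "g = cube_vec {i. g $ i = 1}"
    using g by (auto simp: vec_eq_iff)
  then show "y \<in> range (\<lambda>S. act (cube_vec S) x)"
    using y by (metis rangeI)
next
  fix y assume "y \<in> range (\<lambda>S. act (cube_vec S) x)"
  then obtain S where "y = act (cube_vec S) x"
    by blast
  moreover have "\<forall>i. cube_vec S $ i \<in> {0, 1}"
    by simp
  ultimately show "y \<in> unit_cube act x"
    unfolding unit_cube_def by blast
qed

lemma cube_vec_empty: "cube_vec {} = 0"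
  by (simp add: vec_eq_iff)

lemma cube_vec_insert: "i \<notin> S \<Longrightarrow> cube_vec (insert i S) = gen i + cube_vec S"
  by (auto simp: vec_eq_iff gen_nth)

lemma cube_vec_remove: "i \<in> S \<Longrightarrow> cube_vec (S - {i}) + gen i = cube_vec S"
  by (auto simp: vec_eq_iff gen_nth)

locale grid_action =
  fixes M :: "'a measure" and act :: "int ^ 'd \<Rightarrow> 'a \<Rightarrow> 'a"
  assumes free_action: "free_borel_action M act"
begin

lemma act_measurable: "act g \<in> measurable M M"
proof -
  have "(\<lambda>x. (g, x)) \<in> measurable M (count_space UNIV \<Otimes>\<^sub>M M)"
    by simp
  moreover have "(\<lambda>(g, x). act g x) \<in> measurable (count_space UNIV \<Otimes>\<^sub>M M) M"
    using free_action by (simp add: free_borel_action_def)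
  ultimately show ?thesis
    using measurable_compose by fastforce
qed

lemma act_space [simp]: "x \<in> space M \<Longrightarrow> act g x \<in> space M"
  by (rule measurable_space[OF act_measurable])

lemma act_zero [simp]: "x \<in> space M \<Longrightarrow> act 0 x = x"
  using free_action by (simp add: free_borel_action_def)

lemma act_act: "x \<in> space M \<Longrightarrow> act g (act h x) = act (g + h) x"
  using free_action by (simp add: free_borel_action_def)

section \<open>From invariant tuples to polychromatic colorings\<close>

lemma orthogonally_invariant_cube_vec:
  assumes inv: "orthogonally_invariant_on act i f (orbit act x)"
    and x: "x \<in> space M" and S: "i \<notin> S"
  shows "f (act (cube_vec S + g) x) = f (act g x)"
proof -
  have "finite S" by simp
  then show ?thesis using S
  proof (induction S rule: finite_induct)
    case empty
    then show ?case by (simp add: cube_vec_empty)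
  next
    case (insert j S)
    have "f (act (cube_vec (insert j S) + g) x) = f (act (gen j) (act (cube_vec S + g) x))"
      using insert x by (simp add: cube_vec_insert act_act add.assoc)
    also have "\<dots> = f (act (cube_vec S + g) x)"
      using inv insert.prems by (auto simp: orthogonally_invariant_on_def orbit_def)
    finally show ?case using insert by simp
  qed
qed

text \<open>Steps in directions other than \<open>i\<close> leave \<open>f\<close> unchanged by
  invariance, so only a possible step \<open>gen i\<close> counts, and properness makes it flip the
  value.\<close>

lemma orthogonally_invariant_cube_vec_iff:
  assumes inv: "orthogonally_invariant_on act i f (orbit act x)"
    and proper: "borel_proper_2_coloring M act i f" and x: "x \<in> space M"
  shows "f (act (cube_vec S) x) = 1 \<longleftrightarrow> (f x = 1 \<longleftrightarrow> i \<notin> S)"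
proof (cases "i \<in> S")
  case False
  then show ?thesis
    using orthogonally_invariant_cube_vec[OF inv x, of S 0] x by simp
next
  case True
  have vals: "f y \<in> {0, 1}" if "y \<in> space M" for y
    using proper that
    by (auto simp: borel_proper_2_coloring_def dest: measurable_space)
  have "f (act (cube_vec S) x) = f (act (gen i) x)"
    using orthogonally_invariant_cube_vec[OF inv x, of "S - {i}" "gen i"] True
    by (simp add: cube_vec_remove)
  moreover have "f (act (gen i) x) \<noteq> f x"
    using proper x by (simp add: borel_proper_2_coloring_def)
  ultimately show ?thesis
    using True vals[OF x] vals[OF act_space[OF x], of "gen i"] by auto
qed

lemma invariant_tuple_attains_all:
  fixes c :: "'d \<Rightarrow> 'a \<Rightarrow> nat"
  assumes tuple: "tuple_of_borel_2_colorings M act c"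
    and inv: "fold_invariant M act (CARD('d) - 1) c" and x: "x \<in> space M"
  shows "\<exists>S. {i. c i (act (cube_vec S) x) = 1} = V"
proof -
  have proper: "borel_proper_2_coloring M act i (c i)" for i
    using tuple by (simp add: tuple_of_borel_2_colorings_def)
  let ?I = "{i. orthogonally_invariant_on act i (c i) (orbit act x)}"
  have "CARD('d) - 1 \<le> card ?I"
    using inv x by (simp add: fold_invariant_def)
  then have "card (- ?I) \<le> 1"
    by (simp add: Compl_eq_Diff_UNIV card_Diff_subset)
  then have "\<forall>a\<in>- ?I. \<forall>b\<in>- ?I. a = b"
    using card_le_Suc0_iff_eq[of "- ?I"] by simp
  \<comment> \<open>If all colorings are invariant on the orbit, \<open>k\<close> is an arbitrary
    index.\<close>
  then obtain k where "- ?I \<subseteq> {k}"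
    by blast
  then have invI: "orthogonally_invariant_on act i (c i) (orbit act x)" if "i \<noteq> k" for i
    using that by auto
  \<comment> \<open>\<open>S\<close> collects the directions other than \<open>k\<close> in which
    the value at \<open>x\<close> disagrees with \<open>V\<close>. These are the ones to flip, and
    adding \<open>k\<close> to \<open>S\<close> does not affect them.\<close>
  define S where "S = {i. i \<noteq> k \<and> (c i x = 1 \<longleftrightarrow> i \<notin> V)}"
  have other: "c i (act (cube_vec T) x) = 1 \<longleftrightarrow> i \<in> V" if "i \<noteq> k" "T = S \<or> T = insert k S" for i T
    using orthogonally_invariant_cube_vec_iff[OF invI[OF that(1)] proper x, of T] that
    by (auto simp: S_def)
  have "k \<notin> S" by (simp add: S_def)
  then have "act (cube_vec (insert k S)) x = act (gen k) (act (cube_vec S) x)"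
    using x by (simp add: cube_vec_insert act_act)
  then have "c k (act (cube_vec (insert k S)) x) \<noteq> c k (act (cube_vec S) x)"
    using proper[of k] x by (simp add: borel_proper_2_coloring_def)
  moreover have "c k (act g x) \<in> {0, 1}" for g
    using proper[of k] act_space[OF x, of g]
    by (auto simp: borel_proper_2_coloring_def dest: measurable_space)
  \<comment> \<open>The two candidates differ by \<open>gen k\<close>, which flips
    \<open>c k\<close>, so exactly one of them has the required value.\<close>
  ultimately have "\<exists>T. (T = S \<or> T = insert k S) \<and> (c k (act (cube_vec T) x) = 1 \<longleftrightarrow> k \<in> V)"
    by (metis empty_iff insert_iff)
  then obtain T where T: "T = S \<or> T = insert k S" "c k (act (cube_vec T) x) = 1 \<longleftrightarrow> k \<in> V"
    by blast
  have "c i (act (cube_vec T) x) = 1 \<longleftrightarrow> i \<in> V" for i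
    using other[OF _ T(1), of i] T(2) by (cases "i = k") simp_all
  then have "{i. c i (act (cube_vec T) x) = 1} = V"
    by simp
  then show ?thesis by blast
qed

theorem polychromatic_of_fold_invariant:
  fixes c :: "'d \<Rightarrow> 'a \<Rightarrow> nat"
  assumes tuple: "tuple_of_borel_2_colorings M act c"
    and inv: "fold_invariant M act (CARD('d) - 1) c"
  shows "\<exists>p. borel_polychromatic_coloring M act (2 ^ CARD('d)) p"
proof -
  have "finite (UNIV :: 'd set set)" "card (UNIV :: 'd set set) = 2 ^ CARD('d)"
    using card_Pow[of "UNIV :: 'd set"] by simp_all
  then obtain e where e: "bij_betw e (UNIV :: 'd set set) {..<2 ^ CARD('d) :: nat}"
    using ex_bij_betw_finite_nat[of "UNIV :: 'd set set"] by (auto simp: atLeast0LessThan)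
  \<comment> \<open>The color encodes the whole tuple of values; any numbering \<open>e\<close> of
    the sets of directions will do.\<close>
  define p where "p = (\<lambda>x. e {i. c i x = 1})"
  have [measurable]: "c i \<in> measurable M (count_space {0, 1})" for i
    using tuple by (simp add: tuple_of_borel_2_colorings_def borel_proper_2_coloring_def)
  have "(\<lambda>x. {i. c i x = 1}) -` {V} \<inter> space M \<in> sets M" for V
  proof -
    have "(\<lambda>x. {i. c i x = 1}) -` {V} \<inter> space M = {x \<in> space M. \<forall>i\<in>UNIV. c i x = 1 \<longleftrightarrow> i \<in> V}"
      by auto
    moreover have "{x \<in> space M. \<forall>i\<in>UNIV. c i x = 1 \<longleftrightarrow> i \<in> V} \<in> sets M"
    proof (rule sets.sets_Collect_finite_All')
      show "{x \<in> space M. c i x = 1 \<longleftrightarrow> i \<in> V} \<in> sets M" for i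
        by measurable
    qed auto
    ultimately show ?thesis by simp
  qed
  then have "(\<lambda>x. {i. c i x = 1}) \<in> measurable M (count_space UNIV)"
    by (simp add: measurable_count_space_eq2)
  moreover have "e \<in> measurable (count_space UNIV) (count_space {..<2 ^ CARD('d)})"
    using e by (auto simp: bij_betw_def)
  ultimately have "p \<in> measurable M (count_space {..<2 ^ CARD('d)})"
    unfolding p_def by (rule measurable_compose)
  moreover have "\<exists>y\<in>unit_cube act x. p y = a" if x: "x \<in> space M" and a: "a < 2 ^ CARD('d)" for x a
  proof -
    obtain V where V: "e V = a"
      using e a by (metis bij_betw_imp_surj_on imageE lessThan_iff)
    obtain S where "{i. c i (act (cube_vec S) x) = 1} = V"
      using invariant_tuple_attains_all[OF tuple inv x] by blast
    then have "p (act (cube_vec S) x) = a"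
      by (simp add: p_def V)
    then show ?thesis
      by (auto simp: unit_cube_eq_range)
  qed
  ultimately show ?thesis
    by (auto simp: borel_polychromatic_coloring_def)
qed

section \<open>An invariant coloring in dimension two\<close>

lemma proper_discrepancy_line:
  assumes proper: "borel_proper_2_coloring M act i f" and x: "x \<in> space M"
    and line: "\<And>l. l \<noteq> i \<Longrightarrow> g $ l = h $ l"
  shows "f (act (gen j) (act g x)) = f (act g x) \<longleftrightarrow> f (act (gen j) (act h x)) = f (act h x)"
proof -
  have vals: "f y \<in> {0, 1}" if "y \<in> space M" for y
    using proper that
    by (auto simp: borel_proper_2_coloring_def dest: measurable_space)
  have flip: "f (act (gen i) y) \<noteq> f y" if "y \<in> space M" for y
    using proper that by (simp add: borel_proper_2_coloring_def)
  let ?D = "\<lambda>y. f (act (gen j) y) = f y"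
  \<comment> \<open>The generators commute, so a step \<open>gen i\<close> flips both of the
    compared values. With only two colors, equality and inequality both survive.\<close>
  have step: "?D (act (gen i) y) \<longleftrightarrow> ?D y" if y: "y \<in> space M" for y
  proof -
    have "act (gen j) (act (gen i) y) = act (gen i) (act (gen j) y)"
      using y by (simp add: act_act add.commute)
    then show ?thesis
      using vals[OF y] vals[of "act (gen j) y"] vals[of "act (gen i) y"]
        vals[of "act (gen i) (act (gen j) y)"] flip[OF y] flip[of "act (gen j) y"] y
      by auto
  qed
  have up: "?D (act (axis i (int n)) y) \<longleftrightarrow> ?D y" if y: "y \<in> space M" for n y
  proof (induction n)
    case 0
    have "axis i (int 0) = (0 :: int ^ 'd)" by (simp add: vec_eq_iff axis_def)
    then show ?case using y by (simp only: act_zero)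
  next
    case (Suc n)
    have "axis i (int (Suc n)) = gen i + axis i (int n)"
      by (simp add: vec_eq_iff axis_def gen_def)
    then have "act (axis i (int (Suc n))) y = act (gen i) (act (axis i (int n)) y)"
      using y by (simp add: act_act)
    then show ?case using Suc step y by simp
  qed
  have *: "?D (act h x) \<longleftrightarrow> ?D (act g x)"
    if "g $ i \<le> h $ i" "\<And>l. l \<noteq> i \<Longrightarrow> g $ l = h $ l" for g h
  proof -
    have "h = axis i (int (nat (h $ i - g $ i))) + g"
      using that by (auto simp: vec_eq_iff axis_def)
    then have "act h x = act (axis i (int (nat (h $ i - g $ i)))) (act g x)"
      using x by (simp add: act_act)
    then show ?thesis using up[OF act_space[OF x]] by (simp only:)
  qed
  show ?thesis
    using *[of g h] *[of h g] line by (cases "g $ i \<le> h $ i") auto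
qed

text \<open>The hypothesis \<open>tile\<close> abstracts from the tiling: if
  \<open>f i y = 1\<close>, a step in direction \<open>i\<close> stays inside the tile, hence keeps
  the other coordinates.\<close>

lemma fold_invariant_1_if_tiling_like:
  fixes f :: "'d \<Rightarrow> 'a \<Rightarrow> nat"
  assumes card2: "CARD('d) = 2" and tuple: "tuple_of_borel_2_colorings M act f"
    and tile: "\<And>i j y. y \<in> space M \<Longrightarrow> i \<noteq> j \<Longrightarrow> f i y = 1 \<Longrightarrow> f j (act (gen i) y) = f j y"
  shows "fold_invariant M act 1 f"
  unfolding fold_invariant_def
proof
  fix x assume x: "x \<in> space M"
  have proper: "borel_proper_2_coloring M act i (f i)" for i
    using tuple by (simp add: tuple_of_borel_2_colorings_def)
  have vals: "f i y \<in> {0, 1}" if "y \<in> space M" for i y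
    using proper[of i] that
    by (auto simp: borel_proper_2_coloring_def dest: measurable_space)
  obtain i k :: 'd where ik: "UNIV = {i, k}" "i \<noteq> k"
    using card2 by (metis card_2_iff)
  have "\<exists>l. orthogonally_invariant_on act l (f l) (orbit act x)"
  proof (rule ccontr)
    assume none: "\<not> ?thesis"
    have "\<exists>g. f i (act (gen k) (act g x)) \<noteq> f i (act g x)"
      using none[simplified, rule_format, of i] ik
      by (auto simp: orthogonally_invariant_on_def orbit_def)
    then obtain g where g: "f i (act (gen k) (act g x)) \<noteq> f i (act g x)" by blast
    have "\<exists>g. f k (act (gen i) (act g x)) \<noteq> f k (act g x)"
      using none[simplified, rule_format, of k] ik
      by (auto simp: orthogonally_invariant_on_def orbit_def)
    then obtain g' where g': "f k (act (gen i) (act g' x)) \<noteq> f k (act g' x)" by blast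
    \<comment> \<open>The crossing point of the line through \<open>g\<close> in direction
      \<open>i\<close>, along which \<open>f i\<close> is bad, and the line through
      \<open>g'\<close> in direction \<open>k\<close>, along which \<open>f k\<close> is
      bad.\<close>
    define z where "z = act (\<chi> l. if l = i then g' $ l else g $ l) x"
    have z: "z \<in> space M" using x by (simp add: z_def)
    have "f i (act (gen k) (act g x)) = f i (act g x) \<longleftrightarrow> f i (act (gen k) z) = f i z"
      unfolding z_def by (rule proper_discrepancy_line[OF proper x]) simp
    then have zi: "f i (act (gen k) z) \<noteq> f i z" using g by simp
    have "f k (act (gen i) (act g' x)) = f k (act g' x) \<longleftrightarrow> f k (act (gen i) z) = f k z"
      unfolding z_def using ik by (intro proper_discrepancy_line[OF proper x]) auto
    then have zk: "f k (act (gen i) z) \<noteq> f k z" using g' by simp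
    have "f i (act (gen k) z) = f i z \<longleftrightarrow>
        f i (act (gen k) (act (gen i) z)) = f i (act (gen i) z)"
      using proper_discrepancy_line[OF proper z, where g = 0 and h = "gen i"] z
      by (simp add: gen_nth)
    \<comment> \<open>By \<open>tile\<close>, a change of \<open>f i\<close> under
      \<open>gen k\<close> excludes the value 1 for \<open>f k\<close>. This applies at
      \<open>z\<close> and at its \<open>gen i\<close>-neighbor, so \<open>f k\<close> agrees there,
      against \<open>zk\<close>.\<close>
    then have "f k z = 0" "f k (act (gen i) z) = 0"
      using tile[of z k i] tile[of "act (gen i) z" k i] zi ik z
        vals[OF z] vals[OF act_space[OF z]] by fastforce+
    then show False using zk by simp
  qed
  then show "1 \<le> card {l. orthogonally_invariant_on act l (f l) (orbit act x)}"
    by (auto simp: Suc_le_eq card_gt_0_iff)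
qed

end

section \<open>The 2-colorings read off from a polychromatic coloring\<close>

locale polychromatic_grid_action = grid_action M act
  for M :: "'a measure" and act :: "int ^ 'd \<Rightarrow> 'a \<Rightarrow> 'a" +
  fixes c :: "'a \<Rightarrow> nat"
  assumes polychromatic: "borel_polychromatic_coloring M act (2 ^ CARD('d)) c"
begin

lemma cube_colors_bij:
  assumes x: "x \<in> space M"
  shows "bij_betw (\<lambda>S. c (act (cube_vec S) x)) UNIV {..<2 ^ CARD('d)}"
proof -
  let ?f = "\<lambda>S :: 'd set. c (act (cube_vec S) x)"
  have "c y < 2 ^ CARD('d)" if "y \<in> space M" for y
    using polychromatic that
    by (auto simp: borel_polychromatic_coloring_def dest: measurable_space)
  moreover have "\<exists>S. ?f S = a" if "a < 2 ^ CARD('d)" for a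
    using polychromatic x that
    by (fastforce simp: borel_polychromatic_coloring_def unit_cube_eq_range)
  ultimately have range: "range ?f = {..<2 ^ CARD('d)}"
    using x by (auto simp: image_iff eq_commute)
  then have "card (range ?f) = card (UNIV :: 'd set set)"
    using card_Pow[of "UNIV :: 'd set"] by simp
  then show ?thesis
    using range by (simp add: bij_betw_def eq_card_imp_inj_on)
qed

text \<open>Color 0 is an arbitrary choice. On \<open>space M\<close> the description is unique by
  \<open>cube_colors_bij\<close>.\<close>

definition corner :: "'a \<Rightarrow> 'd set" where
  "corner x = (THE S. c (act (cube_vec S) x) = 0)"

lemma corner_eq_iff:
  assumes x: "x \<in> space M"
  shows "corner x = S \<longleftrightarrow> c (act (cube_vec S) x) = 0"
proof -
  have "0 \<in> range (\<lambda>S. c (act (cube_vec S) x))"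
    using cube_colors_bij[OF x] by (simp add: bij_betw_def)
  then obtain Z where Z: "c (act (cube_vec Z) x) = 0"
    by auto
  have uniq: "T = Z" if "c (act (cube_vec T) x) = 0" for T
    using bij_betw_imp_inj_on[OF cube_colors_bij[OF x]] that Z by (simp add: inj_def)
  have "corner x = Z"
    unfolding corner_def using Z uniq by (rule the_equality)
  then show ?thesis
    using Z uniq[of S] by auto
qed

text \<open>Both points lie in the unit cube based at the coordinatewise minimum \<open>m\<close>,
  and that cube has only one vertex of color 0.\<close>

lemma close_zeros_eq:
  assumes x: "x \<in> space M" and g: "c (act g x) = 0" and h: "c (act h x) = 0"
    and close: "\<And>i. \<bar>g $ i - h $ i\<bar> \<le> 1"
  shows "g = h"
proof -
  define m where "m = (\<chi> i. min (g $ i) (h $ i))"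
  have close': "g $ i \<le> 1 + h $ i" "h $ i \<le> 1 + g $ i" for i
    using close[of i] by auto
  have *: "g = cube_vec {i. h $ i < g $ i} + m" "h = cube_vec {i. g $ i < h $ i} + m"
    unfolding vec_eq_iff m_def using close' by (auto simp: min_def intro: antisym)
  have m: "act m x \<in> space M" using x by simp
  have "corner (act m x) = {i. h $ i < g $ i}" "corner (act m x) = {i. g $ i < h $ i}"
    unfolding corner_eq_iff[OF m] using *[symmetric] g h x by (simp_all add: act_act)
  then show ?thesis using * by simp
qed

text \<open>The vertex of color 0 also lies in the unit cube at \<open>act (gen i) x\<close>, with
  its coordinate \<open>i\<close> lowered to 0.\<close>

lemma corner_step_in:
  assumes x: "x \<in> space M" and i: "i \<in> corner x"
  shows "corner (act (gen i) x) = corner x - {i}"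
proof -
  have "c (act (cube_vec (corner x)) x) = 0"
    using corner_eq_iff[OF x] by blast
  then show ?thesis
    using x cube_vec_remove[OF i] by (simp add: corner_eq_iff act_act)
qed

text \<open>Otherwise the zeros of the two cubes would have coordinates 0 and 1 in direction
  \<open>i\<close> and differ by at most 1 elsewhere, contrary to
  \<open>close_zeros_eq\<close>.\<close>

lemma corner_step_notin:
  assumes x: "x \<in> space M" and i: "i \<notin> corner x"
  shows "i \<in> corner (act (gen i) x)"
proof (rule ccontr)
  let ?S = "corner x" and ?T = "corner (act (gen i) x)"
  assume T: "i \<notin> ?T"
  have "c (act (cube_vec ?S) x) = 0"
    using corner_eq_iff[OF x] by blast
  moreover have "c (act (cube_vec ?T) (act (gen i) x)) = 0"
    using corner_eq_iff[OF act_space[OF x]] by blast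
  then have "c (act (cube_vec ?T + gen i) x) = 0"
    using x by (simp add: act_act)
  ultimately have "cube_vec ?S = cube_vec ?T + gen i"
    by (rule close_zeros_eq[OF x]) (use i T in \<open>auto simp: gen_nth\<close>)
  then have "cube_vec ?S $ i = (cube_vec ?T + gen i) $ i" by simp
  then show False using i T by (simp add: gen_nth)
qed

definition corner_coloring :: "'d \<Rightarrow> 'a \<Rightarrow> nat" where
  "corner_coloring i x = of_bool (i \<in> corner x)"

lemma corner_coloring_measurable:
  "corner_coloring i \<in> measurable M (count_space {0, 1})"
proof -
  have c: "c \<in> measurable M (count_space {..<2 ^ CARD('d)})"
    using polychromatic by (simp add: borel_polychromatic_coloring_def)
  have zero: "{x \<in> space M. c (act (cube_vec S) x) = 0} \<in> sets M" for S
    using measurable_compose[OF act_measurable c, of "cube_vec S"] by measurable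
  \<comment> \<open>Replacing the definite description by a finite union of preimages of color 0
    makes measurability evident.\<close>
  have "{x \<in> space M. i \<in> corner x} = {x \<in> space M. \<exists>S\<in>{S. i \<in> S}. c (act (cube_vec S) x) = 0}"
    using corner_eq_iff by blast
  also have "\<dots> \<in> sets M"
    by (rule sets.sets_Collect_finite_Ex) (use zero in auto)
  finally have [measurable]: "Measurable.pred M (\<lambda>x. i \<in> corner x)"
    by (simp add: pred_def)
  have "(\<lambda>x. if i \<in> corner x then 1 else 0 :: nat) \<in> measurable M (count_space {0, 1})"
    by measurable
  then show ?thesis
    by (simp add: corner_coloring_def[abs_def] of_bool_def)
qed

lemma tuple_corner_coloring: "tuple_of_borel_2_colorings M act corner_coloring"
  unfolding tuple_of_borel_2_colorings_def borel_proper_2_coloring_def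
proof (intro allI conjI ballI)
  fix i x assume "x \<in> space M"
  then show "corner_coloring i (act (gen i) x) \<noteq> corner_coloring i x"
    by (cases "i \<in> corner x") (simp_all add: corner_coloring_def corner_step_in corner_step_notin)
qed (rule corner_coloring_measurable)

lemma corner_coloring_tile:
  assumes "x \<in> space M" "i \<noteq> j" "corner_coloring i x = 1"
  shows "corner_coloring j (act (gen i) x) = corner_coloring j x"
proof -
  have "i \<in> corner x"
    using assms(3) by (cases "i \<in> corner x") (simp_all add: corner_coloring_def)
  then show ?thesis
    using assms(1,2) by (simp add: corner_coloring_def corner_step_in)
qed

end

theorem theorem4p6:
  fixes M :: "'a measure" and act :: "int ^ 'd \<Rightarrow> 'a \<Rightarrow> 'a"
  assumes "standard_borel_space M"
    and "free_borel_action M act"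
  shows "((\<exists>c. borel_polychromatic_coloring M act (2 ^ CARD('d)) c) \<longrightarrow>
            (\<exists>c. tuple_of_borel_2_colorings M act c \<and> fold_invariant M act 0 c)) \<and>
         ((\<exists>c. tuple_of_borel_2_colorings M act c \<and> fold_invariant M act (CARD('d) - 1) c) \<longrightarrow>
            (\<exists>c. borel_polychromatic_coloring M act (2 ^ CARD('d)) c)) \<and>
         (CARD('d) = 2 \<longrightarrow>
            ((\<exists>c. borel_polychromatic_coloring M act 4 c) \<longleftrightarrow>
             (\<exists>c. tuple_of_borel_2_colorings M act c \<and> fold_invariant M act 1 c)))"
proof -
  interpret grid_action M act
    by unfold_locales (rule assms(2))
  have tuple: "\<exists>f. tuple_of_borel_2_colorings M act f \<and> (CARD('d) = 2 \<longrightarrow> fold_invariant M act 1 f)"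
    if "borel_polychromatic_coloring M act (2 ^ CARD('d)) c" for c
  proof -
    interpret polychromatic_grid_action M act c
      by unfold_locales (rule that)
    show ?thesis
      using tuple_corner_coloring
        fold_invariant_1_if_tiling_like[OF _ tuple_corner_coloring corner_coloring_tile] by blast
  qed
  have "(\<exists>c. borel_polychromatic_coloring M act (2 ^ CARD('d)) c) \<longrightarrow>
      (\<exists>c. tuple_of_borel_2_colorings M act c \<and> fold_invariant M act 0 c)"
    using tuple by (auto simp: fold_invariant_def)
  moreover have "(\<exists>c. borel_polychromatic_coloring M act 4 c) \<longleftrightarrow>
      (\<exists>c. tuple_of_borel_2_colorings M act c \<and> fold_invariant M act 1 c)" if card2: "CARD('d) = 2"
    \<comment> \<open>Here \<open>4 = 2 ^ CARD('d)\<close> and \<open>1 = CARD('d) - 1\<close>, so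
      the backward direction is an instance of part (1).\<close>
    using tuple polychromatic_of_fold_invariant by (auto simp: card2)
  ultimately show ?thesis
    using polychromatic_of_fold_invariant by blast
qed

end
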